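(* For any $c,c'\in\mathbb{R}$, the assignment objective $$\sum_i\bigl(c\,A_{i,\mu(i)}+c'\,B_{i,\mu(i)}\bigr)$$ on the cyclic Hollow-Shell $C_n$ has a cyclic-shift optimum, hence a stable optimum. If $c'\ne c$, the appropriate extreme cyclic shift is the unique optimum; if $c'=c$, all matchings have the same value.
   Context: Men and women are each indexed by $\{0,\dots,n-1\}$, identified with $\mathbb{Z}/n\mathbb{Z}$; $x \bmod n$ takes values in $\{0,\dots,n-1\}$. A complete matching is a bijection $\mu$ from men to women (a bijection of indices); the objective is a function of the complete matching $\mu$, and an optimum is a complete matching optimizing it (maximizing or minimizing, whichever sense is chosen). For an instance in which every agent has a strict complete preference order, $r_M(g,h)$ is the rank (1 is best) of woman $h$ in man $g$'s list and $r_W(h,g)$ is the rank of man $g$ in woman $h$'s list. A man-woman pair blocks $\mu$ if each strictly prefers the other to their partner under $\mu$; $\mu$ is stable if it has no blocking pair. The cyclic Hollow-Shell $C_n$ is the size-$n$ instance with $r_M(g,h)=((h-g)\bmod n)+1$ and $r_W(h,g)=n-((h-g)\bmod n)$. Its rank-complement matrices are $A_{ij}=n-r_M(i,j)$ and $B_{ij}=n-r_W(j,i)$. The cyclic shifts are the matchings $\mu_t(g)=g+t$ (indices mod $n$), $t\in\mathbb{Z}/n\mathbb{Z}$; the extreme cyclic shifts are those of constant displacement $t=0$ and $t=n-1$. *)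

theory Defs
  imports Complex_Main
begin

text \<open>
  Men and women are both indexed by \<open>{..<n}\<close>. An instance of size \<open>n\<close> is given by rank functions
  \<open>rM g h\<close> (rank of woman \<open>h\<close> in man \<open>g\<close>'s list) and \<open>rW h g\<close> (rank of man \<open>g\<close> in woman \<open>h\<close>'s
  list), rank 1 being best. Values of ranks and matchings at indices \<open>\<ge> n\<close> carry no meaning.
\<close>

definition strict_complete_instance ::
  "nat \<Rightarrow> (nat \<Rightarrow> nat \<Rightarrow> nat) \<Rightarrow> (nat \<Rightarrow> nat \<Rightarrow> nat) \<Rightarrow> bool" where
  "strict_complete_instance n rM rW \<longleftrightarrow>
     (\<forall>g<n. bij_betw (rM g) {..<n} {1..n}) \<and> (\<forall>h<n. bij_betw (rW h) {..<n} {1..n})"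

definition complete_matching :: "nat \<Rightarrow> (nat \<Rightarrow> nat) \<Rightarrow> bool" where
  "complete_matching n \<mu> \<longleftrightarrow> bij_betw \<mu> {..<n} {..<n}"

definition blocks ::
  "nat \<Rightarrow> (nat \<Rightarrow> nat \<Rightarrow> nat) \<Rightarrow> (nat \<Rightarrow> nat \<Rightarrow> nat) \<Rightarrow> (nat \<Rightarrow> nat) \<Rightarrow> nat \<Rightarrow> nat \<Rightarrow> bool" where
  "blocks n rM rW \<mu> g h \<longleftrightarrow>
     rM g h < rM g (\<mu> g) \<and> rW h g < rW h (inv_into {..<n} \<mu> h)"

definition stable_matching ::
  "nat \<Rightarrow> (nat \<Rightarrow> nat \<Rightarrow> nat) \<Rightarrow> (nat \<Rightarrow> nat \<Rightarrow> nat) \<Rightarrow> (nat \<Rightarrow> nat) \<Rightarrow> bool" where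
  "stable_matching n rM rW \<mu> \<longleftrightarrow>
     complete_matching n \<mu> \<and> \<not> (\<exists>g<n. \<exists>h<n. blocks n rM rW \<mu> g h)"

text \<open>The difference of indices is taken in \<open>int\<close>, since subtraction on \<open>nat\<close> truncates.\<close>

definition displacement :: "nat \<Rightarrow> nat \<Rightarrow> nat \<Rightarrow> nat" where
  "displacement n g h = nat ((int h - int g) mod int n)"

definition hollow_rM :: "nat \<Rightarrow> nat \<Rightarrow> nat \<Rightarrow> nat" where
  "hollow_rM n g h = displacement n g h + 1"

text \<open>No truncation below when \<open>n > 0\<close>, as then \<open>displacement n g h < n\<close>.\<close>

definition hollow_rW :: "nat \<Rightarrow> nat \<Rightarrow> nat \<Rightarrow> nat" where
  "hollow_rW n h g = n - displacement n g h"

definition rank_complement_A :: "nat \<Rightarrow> (nat \<Rightarrow> nat \<Rightarrow> nat) \<Rightarrow> nat \<Rightarrow> nat \<Rightarrow> real" where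
  "rank_complement_A n rM i j = real n - real (rM i j)"

definition rank_complement_B :: "nat \<Rightarrow> (nat \<Rightarrow> nat \<Rightarrow> nat) \<Rightarrow> nat \<Rightarrow> nat \<Rightarrow> real" where
  "rank_complement_B n rW i j = real n - real (rW j i)"

definition hollow_objective :: "nat \<Rightarrow> real \<Rightarrow> real \<Rightarrow> (nat \<Rightarrow> nat) \<Rightarrow> real" where
  "hollow_objective n c c' \<mu> =
     (\<Sum>i<n. c * rank_complement_A n (hollow_rM n) i (\<mu> i)
           + c' * rank_complement_B n (hollow_rW n) i (\<mu> i))"

definition cyclic_shift :: "nat \<Rightarrow> nat \<Rightarrow> nat \<Rightarrow> nat" where
  "cyclic_shift n t g = (g + t) mod n"

datatype sense = Maximize | Minimize

fun at_least_as_good :: "sense \<Rightarrow> real \<Rightarrow> real \<Rightarrow> bool" where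
  "at_least_as_good Maximize x y \<longleftrightarrow> x \<ge> y"
| "at_least_as_good Minimize x y \<longleftrightarrow> x \<le> y"

definition is_optimum :: "sense \<Rightarrow> nat \<Rightarrow> ((nat \<Rightarrow> nat) \<Rightarrow> real) \<Rightarrow> (nat \<Rightarrow> nat) \<Rightarrow> bool" where
  "is_optimum s n obj \<mu> \<longleftrightarrow>
     complete_matching n \<mu> \<and>
     (\<forall>\<nu>. complete_matching n \<nu> \<longrightarrow> at_least_as_good s (obj \<mu>) (obj \<nu>))"

text \<open>Matchings are identified when they agree on \<open>{..<n}\<close>.\<close>

definition is_unique_optimum ::
  "sense \<Rightarrow> nat \<Rightarrow> ((nat \<Rightarrow> nat) \<Rightarrow> real) \<Rightarrow> (nat \<Rightarrow> nat) \<Rightarrow> bool" where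
  "is_unique_optimum s n obj \<mu> \<longleftrightarrow>
     is_optimum s n obj \<mu> \<and> (\<forall>\<nu>. is_optimum s n obj \<nu> \<longrightarrow> (\<forall>g<n. \<nu> g = \<mu> g))"

lemma displacement_less: "n > 0 \<Longrightarrow> displacement n g h < n"
  by (simp add: displacement_def nat_less_iff)

lemma displacement_inj_right:
  assumes "h < n" "h' < n" "displacement n g h = displacement n g h'"
  shows "h = h'"
proof -
  have "(int h - int g) mod int n = (int h' - int g) mod int n"
    using assms by (simp add: displacement_def eq_nat_nat_iff)
  then have "(int h - int g + int g) mod int n = (int h' - int g + int g) mod int n"
    by (metis mod_add_left_eq)
  then show ?thesis using assms by simp
qed

lemma displacement_inj_left:
  assumes "g < n" "g' < n" "displacement n g h = displacement n g' h"
  shows "g = g'"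
proof -
  have "(int h - int g) mod int n = (int h - int g') mod int n"
    using assms by (simp add: displacement_def eq_nat_nat_iff)
  then have "(int h - (int h - int g)) mod int n = (int h - (int h - int g')) mod int n"
    by (metis mod_diff_right_eq)
  then show ?thesis using assms by simp
qed

lemma strict_complete_instance_hollow:
  "strict_complete_instance n (hollow_rM n) (hollow_rW n)"
proof -
  have bij: "bij_betw f {..<n} {1..n}"
    if "inj_on f {..<n}" "f ` {..<n} \<subseteq> {1..n}" for f :: "nat \<Rightarrow> nat"
    using that by (simp add: bij_betw_def card_image card_subset_eq)
  have "bij_betw (hollow_rM n g) {..<n} {1..n}" if "g < n" for g
    using that displacement_less[of n g]
    by (intro bij) (auto simp: hollow_rM_def Suc_le_eq intro!: inj_onI dest: displacement_inj_right)
  moreover have "bij_betw (hollow_rW n h) {..<n} {1..n}" if "h < n" for h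
  proof (rule bij)
    have less: "displacement n g h < n" for g
      using that by (intro displacement_less) simp
    show "hollow_rW n h ` {..<n} \<subseteq> {1..n}"
      using less by (auto simp: hollow_rW_def Suc_le_eq)
    show "inj_on (hollow_rW n h) {..<n}"
    proof (rule inj_onI)
      fix g g' assume a: "g \<in> {..<n}" "g' \<in> {..<n}" "hollow_rW n h g = hollow_rW n h g'"
      then have "displacement n g h = displacement n g' h"
        using less[of g] less[of g'] by (simp add: hollow_rW_def)
      then show "g = g'" using a displacement_inj_left by simp
    qed
  qed
  ultimately show ?thesis by (simp add: strict_complete_instance_def)
qed

end

theory Submission
  imports Defs
begin

text \<open>
  Since \<open>A\<^sub>i\<^sub>j = n - 1 - d\<close> and \<open>B\<^sub>i\<^sub>j = d\<close> for the displacement \<open>d = (j - i) mod n\<close>, the objective is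
  a constant plus \<open>c' - c\<close> times the total displacement of the matching. Each displacement lies
  between \<open>0\<close> and \<open>n - 1\<close>, so the total is extremal exactly when all of them are \<open>0\<close>, or all are
  \<open>n - 1\<close>. A matching of constant displacement \<open>t\<close> is stable, because a man only prefers women at
  displacement below \<open>t\<close>, while a woman only prefers men at displacement above \<open>t\<close>.
\<close>

lemma displacement_cyclic_shift:
  assumes "t < n"
  shows "displacement n g (cyclic_shift n t g) = t"
proof -
  have "(int ((g + t) mod n) - int g) mod int n = (int (g + t) - int g) mod int n"
    by (simp only: zmod_int mod_diff_left_eq)
  also have "\<dots> = int t"
    using assms by simp
  finally show ?thesis
    by (simp add: displacement_def cyclic_shift_def)
qed

lemma cyclic_shift_less: "n > 0 \<Longrightarrow> cyclic_shift n t g < n"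
  by (simp add: cyclic_shift_def)

lemma complete_matching_cyclic_shift:
  assumes "t < n"
  shows "complete_matching n (cyclic_shift n t)"
proof -
  \<comment> \<open>A woman and the common displacement \<open>t\<close> determine the man;
    surjectivity then follows by finiteness.\<close>
  have "inj_on (cyclic_shift n t) {..<n}"
    by (rule inj_onI) (metis assms displacement_cyclic_shift displacement_inj_left lessThan_iff)
  moreover have "cyclic_shift n t ` {..<n} \<subseteq> {..<n}"
    using assms by (auto intro: cyclic_shift_less)
  ultimately show ?thesis
    by (simp add: complete_matching_def bij_betw_def endo_inj_surj)
qed

lemma complete_matching_less: "complete_matching n \<mu> \<Longrightarrow> g < n \<Longrightarrow> \<mu> g < n"
  by (auto simp: complete_matching_def dest: bij_betwE)

lemma stable_matching_cyclic_shift: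
  assumes "t < n"
  shows "stable_matching n (hollow_rM n) (hollow_rW n) (cyclic_shift n t)"
proof -
  have bij: "bij_betw (cyclic_shift n t) {..<n} {..<n}"
    using complete_matching_cyclic_shift[OF assms] by (simp add: complete_matching_def)
  have False if "g < n" "h < n" and b: "blocks n (hollow_rM n) (hollow_rW n) (cyclic_shift n t) g h"
    for g h
  proof -
    have "cyclic_shift n t (inv_into {..<n} (cyclic_shift n t) h) = h"
      using bij \<open>h < n\<close> by (simp add: bij_betw_inv_into_right)
    then have "displacement n (inv_into {..<n} (cyclic_shift n t) h) h = t"
      by (metis assms displacement_cyclic_shift)
    \<comment> \<open>Complementing ranks reverses the order, so the woman's preference means
      displacement above \<open>t\<close>, against the man's.\<close>
    with b have "displacement n g h < t" "n - displacement n g h < n - t"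
      by (simp_all add: blocks_def hollow_rM_def hollow_rW_def displacement_cyclic_shift[OF assms])
    then show False
      by linarith
  qed
  then show ?thesis
    using complete_matching_cyclic_shift[OF assms] by (auto simp: stable_matching_def)
qed

text \<open>The factor \<open>c' - c\<close> stays inside the sum so that two matchings can be
  compared man by man.\<close>

lemma hollow_objective_eq:
  assumes "n > 0"
  shows "hollow_objective n c c' \<mu> =
    real n * (c * (real n - 1)) + (\<Sum>i<n. (c' - c) * real (displacement n i (\<mu> i)))"
proof -
  \<comment> \<open>The bound \<open>d < n\<close> keeps the natural subtraction
    \<open>n - d\<close> from truncating.\<close>
  have "c * (real n - real (d + 1)) + c' * (real n - real (n - d)) =
      c * (real n - 1) + (c' - c) * real d" if "d < n" for d
    using that by (simp add: of_nat_diff algebra_simps)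
  then have "hollow_objective n c c' \<mu> =
      (\<Sum>i<n. c * (real n - 1) + (c' - c) * real (displacement n i (\<mu> i)))"
    unfolding hollow_objective_def rank_complement_A_def rank_complement_B_def
      hollow_rM_def hollow_rW_def
    by (intro sum.cong refl) (simp only: displacement_less[OF assms])
  then show ?thesis
    by (simp add: sum.distrib)
qed

lemma at_least_as_good_linear: "at_least_as_good s x y \<or> at_least_as_good s y x"
  by (cases s) auto

lemma at_least_as_good_refl: "at_least_as_good s x x"
  by (cases s) auto

text \<open>Values are linearly ordered, so failing to be at least as good means being strictly
  worse. Terms that tie or are worse, with one of them worse, make the whole sum worse, in either
  sense.\<close>

lemma sum_not_at_least_as_good:
  fixes f h :: "'a \<Rightarrow> real"
  assumes "finite I" and g: "g \<in> I" "f g \<noteq> h g"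
    and worse: "\<And>i. i \<in> I \<Longrightarrow> f i \<noteq> h i \<Longrightarrow> \<not> at_least_as_good s (f i) (h i)"
  shows "\<not> at_least_as_good s (a + sum f I) (a + sum h I)"
proof (cases s)
  case Maximize
  then have "f i \<le> h i" if "i \<in> I" for i
    using worse[OF that] by fastforce
  then have "sum f I < sum h I"
    using assms(1) g by (intro sum_strict_mono_ex1) (auto simp: less_le)
  with Maximize show ?thesis by simp
next
  case Minimize
  then have "h i \<le> f i" if "i \<in> I" for i
    using worse[OF that] by fastforce
  then have "sum h I < sum f I"
    using assms(1) g by (intro sum_strict_mono_ex1) (auto simp: less_le dest: not_sym)
  with Minimize show ?thesis by simp
qed

text \<open>The assumption \<open>worse\<close> concerns a single man's displacement; one argument
  thus serves both senses and both signs of \<open>c' - c\<close>.\<close>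

lemma is_unique_optimum_cyclic_shift:
  assumes "t < n" "c \<noteq> c'"
    and worse: "\<And>d. d < n \<Longrightarrow> d \<noteq> t \<Longrightarrow>
      \<not> at_least_as_good s ((c' - c) * real d) ((c' - c) * real t)"
  shows "is_unique_optimum s n (hollow_objective n c c') (cyclic_shift n t)"
proof -
  let ?obj = "hollow_objective n c c'" and ?\<mu> = "cyclic_shift n t"
  have n: "n > 0" using assms(1) by simp
  have strict: "\<not> at_least_as_good s (?obj \<nu>) (?obj ?\<mu>)"
    if \<nu>: "complete_matching n \<nu>" and g: "g < n" "\<nu> g \<noteq> ?\<mu> g" for \<nu> g
  proof -
    \<comment> \<open>For a fixed man, distinct women have distinct displacements; since
      \<open>c \<noteq> c'\<close>, the summands at \<open>g\<close> differ too.\<close>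
    have "displacement n g (\<nu> g) \<noteq> t"
      by (metis displacement_inj_right displacement_cyclic_shift[OF assms(1)]
          complete_matching_less[OF \<nu>] cyclic_shift_less[OF n] g)
    then show ?thesis
      unfolding hollow_objective_eq[OF n] displacement_cyclic_shift[OF assms(1)]
      using g \<open>c \<noteq> c'\<close>
      by (intro sum_not_at_least_as_good[of _ g] worse displacement_less[OF n]) auto
  qed
  have "at_least_as_good s (?obj ?\<mu>) (?obj \<nu>)" if "complete_matching n \<nu>" for \<nu>
  proof (cases "\<forall>g<n. \<nu> g = ?\<mu> g")
    case True
    then have "?obj \<nu> = ?obj ?\<mu>"
      by (simp add: hollow_objective_def)
    then show ?thesis
      by (simp add: at_least_as_good_refl)
  next
    case False
    with strict[OF that] at_least_as_good_linear show ?thesis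
      by blast
  qed
  then have "is_optimum s n ?obj ?\<mu>"
    using complete_matching_cyclic_shift[OF assms(1)] by (simp add: is_optimum_def)
  then show ?thesis
    using strict by (auto simp: is_unique_optimum_def is_optimum_def)
qed

theorem proposition7p2:
  fixes n :: nat and c c' :: real
  assumes "n \<ge> 1"
  shows
    "(\<forall>s. \<exists>t<n. is_optimum s n (hollow_objective n c c') (cyclic_shift n t) \<and>
                stable_matching n (hollow_rM n) (hollow_rW n) (cyclic_shift n t)) \<and>
     (c' > c \<longrightarrow>
        is_unique_optimum Maximize n (hollow_objective n c c') (cyclic_shift n (n - 1)) \<and>
        is_unique_optimum Minimize n (hollow_objective n c c') (cyclic_shift n 0)) \<and>
     (c' < c \<longrightarrow>
        is_unique_optimum Maximize n (hollow_objective n c c') (cyclic_shift n 0) \<and>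
        is_unique_optimum Minimize n (hollow_objective n c c') (cyclic_shift n (n - 1))) \<and>
     (c' = c \<longrightarrow>
        (\<forall>\<mu> \<nu>. complete_matching n \<mu> \<and> complete_matching n \<nu> \<longrightarrow>
           hollow_objective n c c' \<mu> = hollow_objective n c c' \<nu>))"
proof -
  have n: "n > 0" and t: "0 < n" "n - 1 < n"
    using assms by auto
  let ?obj = "hollow_objective n c c'"
  have gt: "is_unique_optimum Maximize n ?obj (cyclic_shift n (n - 1)) \<and>
      is_unique_optimum Minimize n ?obj (cyclic_shift n 0)" if "c' > c"
    using that t
    by (intro conjI is_unique_optimum_cyclic_shift) (auto simp: not_le)
  have lt: "is_unique_optimum Maximize n ?obj (cyclic_shift n 0) \<and>
      is_unique_optimum Minimize n ?obj (cyclic_shift n (n - 1))" if "c' < c"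
    using that t
    by (intro conjI is_unique_optimum_cyclic_shift)
      (auto simp: not_le mult_less_0_iff)
  have eq: "?obj \<mu> = ?obj \<nu>" if "c' = c" for \<mu> \<nu>
    using that by (simp add: hollow_objective_eq[OF n])
  have "\<exists>t<n. is_optimum s n ?obj (cyclic_shift n t)" for s
  proof (cases "c' = c")
    case True
    \<comment> \<open>The objective is constant here, so any shift would serve as witness.\<close>
    have "is_optimum s n ?obj (cyclic_shift n 0)"
      unfolding is_optimum_def
      by (metis True eq at_least_as_good_refl complete_matching_cyclic_shift n)
    with n show ?thesis by blast
  next
    case False
    with gt lt t show ?thesis
      unfolding is_unique_optimum_def by (cases s) (meson linorder_neqE)+
  qed
  then show ?thesis
    using gt lt eq stable_matching_cyclic_shift by blast
qed

end
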